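(* For any $\boldsymbol{\eta}=(\eta_k)_{k\in\mathbb{N}}\in(0,\infty)^{\mathbb{N}}$, any $n\in\mathbb{N}$, and any $m\in\{1,\ldots,n\}$ such that $\eta_m>1$, we have $$R_n(\boldsymbol{\eta})\ge\frac{(\eta_m-1)^2}{(1+\eta_{1:m-1})^2(1+2\eta_{m+1:n})},\qquad G_n(\boldsymbol{\eta})\ge\frac{(\eta_m-1)^2}{(1+2\eta_{1:m-1})(1+\eta_{m+1:n})^2}.$$ In particular, for any $\boldsymbol{\eta}\in(0,\infty)^{\mathbb{N}}$ and any $n\in\mathbb{N}$, $$\eta_n\le 1+(1+\eta_{1:n-1})\sqrt{R_n(\boldsymbol{\eta})},\qquad \eta_n\le 1+\sqrt{1+2\eta_{1:n-1}}\,\sqrt{G_n(\boldsymbol{\eta})}.$$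
   Context: $\mathbb{N}=\{1,2,3,\ldots\}$, $\|\cdot\|$ is the $\ell_2$-norm. Partial sums: $\eta_{m:n}=\sum_{k=m}^n\eta_k$ if $m\le n$, and $\eta_{m:n}=0$ if $m>n$. A differentiable function $f:\mathbb{R}^d\to\mathbb{R}$ is $1$-smooth if $\|\nabla f(x)-\nabla f(y)\|\le\|x-y\|$ for all $x,y\in\mathbb{R}^d$. Let $\mathscr{F}_1(\mathbb{R}^d)$ be the class of convex $1$-smooth functions $f:\mathbb{R}^d\to\mathbb{R}$ whose set of minimizers $X_f^\star=\arg\min_{x\in\mathbb{R}^d}f(x)$ is nonempty. Given a stepsize schedule $\boldsymbol{\eta}=(\eta_k)_{k\in\mathbb{N}}$, gradient descent (GD) on $f$ from $x_1\in\mathbb{R}^d$ generates $x_{k+1}=x_k-\eta_k\nabla f(x_k)$ for all $k\in\mathbb{N}$. Define $$R_n(\boldsymbol{\eta})=\sup_{d\in\mathbb{N}}\ \sup_{f\in\mathscr{F}_1(\mathbb{R}^d)}\ \sup_{x^\star\in X_f^\star}\ \sup_{x_1\in\mathbb{R}^d\setminus X_f^\star}\frac{f(x_{n+1})-f(x^\star)}{\frac12\|x_1-x^\star\|^2},$$ $$G_n(\boldsymbol{\eta})=\sup_{d\in\mathbb{N}}\ \sup_{f\in\mathscr{F}_1(\mathbb{R}^d)}\ \sup_{x^\star\in X_f^\star}\ \sup_{x_1\in\mathbb{R}^d\setminus X_f^\star}\frac{\frac12\|\nabla f(x_{n+1})\|^2}{f(x_1)-f(x^\star)},$$ where $x_{n+1}$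 is the GD iterate after $n$ steps on $f$ started at $x_1$. *)

theory Defs
  imports "HOL-Analysis.Analysis"
begin

text \<open>
  The dimension is quantified inside the two suprema below, so it cannot be a type.
  The space of dimension \<open>d\<close> is the carrier of the library's \<open>Euclidean_space d\<close>:
  the sequences \<open>x :: nat \<Rightarrow> real\<close> with \<open>x i = 0\<close> for \<open>i \<ge> d\<close>.
  Functions on it are total functions whose values outside the carrier are never used.
\<close>

abbreviation espace :: "nat \<Rightarrow> (nat \<Rightarrow> real) set" where
  "espace d \<equiv> topspace (Euclidean_space d)"

definition enorm :: "nat \<Rightarrow> (nat \<Rightarrow> real) \<Rightarrow> real" where
  "enorm d x = L2_set x {..<d}"

definition edist :: "nat \<Rightarrow> (nat \<Rightarrow> real) \<Rightarrow> (nat \<Rightarrow> real) \<Rightarrow> real" where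
  "edist d x y = enorm d (\<lambda>i. x i - y i)"

text \<open>\<open>g\<close> represents the Frechet derivative of \<open>f\<close> at \<open>x\<close> with respect to the inner product.\<close>

definition has_grad ::
    "nat \<Rightarrow> ((nat \<Rightarrow> real) \<Rightarrow> real) \<Rightarrow> (nat \<Rightarrow> real) \<Rightarrow> (nat \<Rightarrow> real) \<Rightarrow> bool" where
  "has_grad d f g x \<longleftrightarrow> g \<in> espace d \<and>
     (\<forall>e>0. \<exists>\<delta>>0. \<forall>y\<in>espace d. edist d y x < \<delta> \<longrightarrow>
        \<bar>f y - f x - (\<Sum>i<d. g i * (y i - x i))\<bar> \<le> e * edist d y x)"

text \<open>Such a \<open>g\<close> is unique, so the description is proper wherever \<open>f\<close> is differentiable.\<close>

definition grad :: "nat \<Rightarrow> ((nat \<Rightarrow> real) \<Rightarrow> real) \<Rightarrow> (nat \<Rightarrow> real) \<Rightarrow> nat \<Rightarrow> real" where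
  "grad d f x = (THE g. has_grad d f g x)"

definition differentiable_fun :: "nat \<Rightarrow> ((nat \<Rightarrow> real) \<Rightarrow> real) \<Rightarrow> bool" where
  "differentiable_fun d f \<longleftrightarrow> (\<forall>x\<in>espace d. \<exists>g. has_grad d f g x)"

definition one_smooth :: "nat \<Rightarrow> ((nat \<Rightarrow> real) \<Rightarrow> real) \<Rightarrow> bool" where
  "one_smooth d f \<longleftrightarrow> differentiable_fun d f \<and>
     (\<forall>x\<in>espace d. \<forall>y\<in>espace d. edist d (grad d f x) (grad d f y) \<le> edist d x y)"

definition convex_fun :: "nat \<Rightarrow> ((nat \<Rightarrow> real) \<Rightarrow> real) \<Rightarrow> bool" where
  "convex_fun d f \<longleftrightarrow> (\<forall>x\<in>espace d. \<forall>y\<in>espace d. \<forall>t\<in>{0..1}.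
     f (\<lambda>i. (1 - t) * x i + t * y i) \<le> (1 - t) * f x + t * f y)"

definition minimizers :: "nat \<Rightarrow> ((nat \<Rightarrow> real) \<Rightarrow> real) \<Rightarrow> (nat \<Rightarrow> real) set" where
  "minimizers d f = {x. is_arg_min f (\<lambda>y. y \<in> espace d) x}"

definition F1 :: "nat \<Rightarrow> ((nat \<Rightarrow> real) \<Rightarrow> real) set" where
  "F1 d = {f. convex_fun d f \<and> one_smooth d f \<and> minimizers d f \<noteq> {}}"

text \<open>
  \<open>gd d f \<eta> x\<^sub>1 k\<close> is the iterate after \<open>k\<close> steps, that is \<open>x\<^bsub>k+1\<^esub>\<close>.
  Step \<open>k\<close> uses \<open>\<eta> k\<close>, with \<open>k\<close> starting at \<open>1\<close>; the value \<open>\<eta> 0\<close> is never used.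
\<close>

primrec gd ::
    "nat \<Rightarrow> ((nat \<Rightarrow> real) \<Rightarrow> real) \<Rightarrow> (nat \<Rightarrow> real) \<Rightarrow> (nat \<Rightarrow> real) \<Rightarrow> nat \<Rightarrow> (nat \<Rightarrow> real)" where
  "gd d f \<eta> x1 0 = x1"
| "gd d f \<eta> x1 (Suc k) =
     (\<lambda>i. gd d f \<eta> x1 k i - \<eta> (Suc k) * grad d f (gd d f \<eta> x1 k) i)"

text \<open>
  The suprema are taken in the extended reals, so no boundedness is presupposed.
  A constant \<open>f\<close> leaves no admissible \<open>x1\<close>; its inner supremum is \<open>-\<infinity>\<close> and does not contribute.
\<close>

definition R_rate :: "nat \<Rightarrow> (nat \<Rightarrow> real) \<Rightarrow> ereal" where
  "R_rate n \<eta> =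
     (SUP d\<in>{1..}. SUP f\<in>F1 d. SUP xs\<in>minimizers d f. SUP x1\<in>espace d - minimizers d f.
        ereal ((f (gd d f \<eta> x1 n) - f xs) / (1/2 * (edist d x1 xs)\<^sup>2)))"

definition G_rate :: "nat \<Rightarrow> (nat \<Rightarrow> real) \<Rightarrow> ereal" where
  "G_rate n \<eta> =
     (SUP d\<in>{1..}. SUP f\<in>F1 d. SUP xs\<in>minimizers d f. SUP x1\<in>espace d - minimizers d f.
        ereal ((1/2 * (enorm d (grad d f (gd d f \<eta> x1 n)))\<^sup>2) / (f x1 - f xs)))"

text \<open>Square root on \<open>[0, \<infinity>]\<close>; other arguments do not matter.\<close>

definition esqrt :: "ereal \<Rightarrow> ereal" where
  "esqrt x = (if x = \<infinity> then \<infinity> else ereal (sqrt (real_of_ereal x)))"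

end

theory Submission
  imports Defs
begin

text \<open>
  One dimension suffices. Take the convex function that is \<open>x\<^sup>2/2\<close> on \<open>[-b, 1]\<close> and affine outside,
  with slopes \<open>-b\<close> and \<open>1\<close>, and start at \<open>1 + \<eta>\<^bsub>1:m-1\<^esub>\<close>. The first \<open>m - 1\<close> steps walk down the right
  slope exactly to \<open>1\<close>, and step \<open>m\<close> overshoots to \<open>-y\<close> with \<open>y = \<eta>\<^sub>m - 1\<close>. If
  \<open>b (1 + \<eta>\<^bsub>m+1:n\<^esub>) \<le> y\<close>, the remaining steps all stay on the left slope. The choice
  \<open>b = y / (1 + 2 \<eta>\<^bsub>m+1:n\<^esub>)\<close> maximises the final function value, and \<open>b = y / (1 + \<eta>\<^bsub>m+1:n\<^esub>)\<close>
  maximises the final gradient.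
\<close>

section \<open>One-dimensional instances of the class \<open>F1\<close>\<close>

definition emb :: "real \<Rightarrow> nat \<Rightarrow> real" where
  "emb t = (\<lambda>i. if i = 0 then t else 0)"

lemma emb_0 [simp]: "emb t 0 = t"
  by (simp add: emb_def)

lemma emb_in_espace [simp]: "emb t \<in> espace (Suc 0)"
  by (simp add: emb_def topspace_Euclidean_space)

lemma espace_1E:
  assumes "x \<in> espace (Suc 0)"
  obtains t where "x = emb t"
proof
  show "x = emb (x 0)"
    using assms by (auto simp: emb_def topspace_Euclidean_space fun_eq_iff)
qed

lemma enorm_1 [simp]: "enorm (Suc 0) x = \<bar>x 0\<bar>"
  by (simp add: enorm_def L2_set_def)

lemma edist_1 [simp]: "edist (Suc 0) x y = \<bar>x 0 - y 0\<bar>"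
  by (simp add: edist_def)

definition lift1 :: "(real \<Rightarrow> real) \<Rightarrow> (nat \<Rightarrow> real) \<Rightarrow> real" where
  "lift1 h x = h (x 0)"

text \<open>The carrier in dimension one is the image of \<open>emb\<close>, so the epsilon-delta
  condition over its points becomes the usual one over reals.\<close>

lemma has_grad_lift1_iff:
  "has_grad (Suc 0) (lift1 h) g x \<longleftrightarrow>
     g \<in> espace (Suc 0) \<and> (h has_real_derivative g 0) (at (x 0))"
proof -
  have ball_espace: "(\<forall>y\<in>espace (Suc 0). P (y 0)) \<longleftrightarrow> (\<forall>t. P t)" for P :: "real \<Rightarrow> bool"
    by (metis emb_0 emb_in_espace)
  show ?thesis
    unfolding has_grad_def has_field_derivative_def has_derivative_at_alt lift1_def
    using ball_espace[of "\<lambda>t. \<bar>t - x 0\<bar> < d \<longrightarrow>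
        \<bar>h t - h (x 0) - g 0 * (t - x 0)\<bar> \<le> e * \<bar>t - x 0\<bar>" for d e]
    by (simp add: bounded_linear_mult_right)
qed

lemma grad_lift1:
  assumes "(h has_real_derivative D) (at (x 0))"
  shows "grad (Suc 0) (lift1 h) x = emb D"
  unfolding grad_def
proof (rule the_equality)
  show "has_grad (Suc 0) (lift1 h) (emb D) x"
    using assms by (simp add: has_grad_lift1_iff)
next
  fix g assume "has_grad (Suc 0) (lift1 h) g x"
  then show "g = emb D"
    using DERIV_unique[OF assms] by (auto simp: has_grad_lift1_iff elim!: espace_1E)
qed

lemma minimizers_lift1: "emb t \<in> minimizers (Suc 0) (lift1 h) \<longleftrightarrow> (\<forall>s. h t \<le> h s)"
proof -
  have "(\<forall>y\<in>espace (Suc 0). h t \<le> h (y 0)) \<longleftrightarrow> (\<forall>s. h t \<le> h s)"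
    by (metis emb_0 emb_in_espace)
  then show ?thesis
    by (auto simp: minimizers_def is_arg_min_linorder lift1_def)
qed

text \<open>Convexity comes from the monotone derivative; \<open>t\<close> witnesses that a
  minimizer exists.\<close>

lemma lift1_in_F1:
  assumes deriv: "\<And>x. (h has_real_derivative h' x) (at x)"
    and mono: "mono h'" and lip: "\<And>x y. \<bar>h' x - h' y\<bar> \<le> \<bar>x - y\<bar>"
    and min: "\<And>s. h t \<le> h s"
  shows "lift1 h \<in> F1 (Suc 0)"
proof -
  have "convex_on UNIV h"
    using monoD[OF mono] by (intro convex_on_realI[where f' = h'] deriv) auto
  then have "convex_fun (Suc 0) (lift1 h)"
    by (auto simp: convex_fun_def lift1_def dest: convex_onD)
  moreover have "has_grad (Suc 0) (lift1 h) (emb (h' (x 0))) x" for x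
    using deriv by (simp add: has_grad_lift1_iff)
  then have "one_smooth (Suc 0) (lift1 h)"
    using lip by (auto simp: one_smooth_def differentiable_fun_def grad_lift1[OF deriv])
  moreover have "emb t \<in> minimizers (Suc 0) (lift1 h)"
    using min by (simp add: minimizers_lift1)
  ultimately show ?thesis
    by (auto simp: F1_def)
qed

section \<open>The Huber function and its derivative\<close>

text \<open>The remainder is at most \<open>(y - x)^2\<close> in every sign case, the kink at 0
  included, so \<open>e\<close> itself serves as the radius for tolerance \<open>e\<close>.\<close>

lemma has_real_derivative_pos_part_sq:
  "((\<lambda>x::real. (max 0 x)\<^sup>2) has_real_derivative 2 * max 0 x) (at x)"
proof -
  have bound: "\<bar>(max 0 y)\<^sup>2 - (max 0 x)\<^sup>2 - 2 * max 0 x * (y - x)\<bar> \<le> \<bar>y - x\<bar> * \<bar>y - x\<bar>"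
    for y :: real
  proof -
    consider "x \<ge> 0" "y \<ge> 0" | "x \<ge> 0" "y < 0" | "x < 0" "y < 0" | "x < 0" "y \<ge> 0"
      by linarith
    then show ?thesis
    proof cases
      case 1
      then have "(max 0 y)\<^sup>2 - (max 0 x)\<^sup>2 - 2 * max 0 x * (y - x) = (y - x) * (y - x)"
        by (simp add: power2_eq_square algebra_simps)
      then show ?thesis by (simp add: abs_mult)
    next
      case 2
      \<comment> \<open>The remainder is \<open>x^2 - 2 * x * y\<close>, which is nonnegative and
        falls short of \<open>(y - x)^2\<close> by \<open>y^2\<close>.\<close>
      have "2 * (x * y) \<le> 0" "0 \<le> y * y" using 2 by (auto simp: mult_nonneg_nonpos)
      moreover have "0 \<le> x * x - 2 * (x * y)" using calculation(1) zero_le_square[of x] by linarith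
      ultimately show ?thesis
        using 2 by (simp add: power2_eq_square algebra_simps abs_mult_self_eq max_def)
    next
      case 3
      then show ?thesis by simp
    next
      case 4
      have "y * y \<le> (y - x) * (y - x)" using 4 by (intro mult_mono) auto
      then show ?thesis using 4 by (simp add: power2_eq_square abs_mult_self_eq)
    qed
  qed
  show ?thesis
    unfolding has_field_derivative_def has_derivative_at_alt
  proof (intro conjI allI impI)
    fix e :: real assume "0 < e"
    have "norm ((max 0 y)\<^sup>2 - (max 0 x)\<^sup>2 - 2 * max 0 x * (y - x)) \<le> e * norm (y - x)"
      if "norm (y - x) < e" for y
      using bound[of y] mult_right_mono[of "\<bar>y - x\<bar>" e "\<bar>y - x\<bar>"] that by auto
    then show "\<exists>d>0. \<forall>y. norm (y - x) < d \<longrightarrow>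
        norm ((max 0 y)\<^sup>2 - (max 0 x)\<^sup>2 - 2 * max 0 x * (y - x)) \<le> e * norm (y - x)"
      using \<open>0 < e\<close> by blast
  qed (rule bounded_linear_mult_right)
qed

text \<open>The Huber function with thresholds \<open>-b\<close> and \<open>1\<close>, as the square corrected outside \<open>[-b, 1]\<close>.\<close>

definition huber :: "real \<Rightarrow> real \<Rightarrow> real" where
  "huber b x = x\<^sup>2 / 2 - (max 0 (x - 1))\<^sup>2 / 2 - (max 0 (- b - x))\<^sup>2 / 2"

text \<open>For \<open>0 < b\<close> this clamps \<open>x\<close> to \<open>[-b, 1]\<close>; hence
  it is monotone and 1-Lipschitz.\<close>

definition huber' :: "real \<Rightarrow> real \<Rightarrow> real" where
  "huber' b x = x - max 0 (x - 1) + max 0 (- b - x)"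

lemma DERIV_huber: "(huber b has_real_derivative huber' b x) (at x)"
  unfolding huber_def huber'_def
  by (rule derivative_eq_intros DERIV_chain2[OF has_real_derivative_pos_part_sq] refl | simp)+

context
  fixes b :: real
  assumes b: "0 < b"
begin

lemma huber_right: "1 \<le> x \<Longrightarrow> huber b x = x - 1 / 2"
  using b by (simp add: huber_def power2_eq_square field_simps)

lemma huber_left: "x \<le> - b \<Longrightarrow> huber b x = - b * x - b\<^sup>2 / 2"
  using b by (simp add: huber_def power2_eq_square field_simps)

lemma huber_middle: "- b \<le> x \<Longrightarrow> x \<le> 1 \<Longrightarrow> huber b x = x\<^sup>2 / 2"
  by (simp add: huber_def)

lemma huber'_right: "1 \<le> x \<Longrightarrow> huber' b x = 1"
  using b by (simp add: huber'_def)

lemma huber'_left: "x \<le> - b \<Longrightarrow> huber' b x = - b"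
  using b by (simp add: huber'_def)

lemma huber_0 [simp]: "huber b 0 = 0"
  using b by (simp add: huber_middle)

lemma huber_nonneg: "0 \<le> huber b x"
proof -
  consider "1 \<le> x" | "- b \<le> x" "x \<le> 1" | "x \<le> - b" by linarith
  then show ?thesis
  proof cases
    case 3
    have "b * b \<le> b * (- x)" using b 3 by (intro mult_left_mono) auto
    moreover have "0 \<le> b * b" by simp
    ultimately have "0 \<le> b * (- x) - b * b / 2" by linarith
    with 3 show ?thesis by (simp add: huber_left power2_eq_square)
  qed (auto simp: huber_right huber_middle)
qed

lemma huber_in_F1: "lift1 (huber b) \<in> F1 (Suc 0)"
proof (rule lift1_in_F1[OF DERIV_huber])
  show "mono (huber' b)"
    using b by (auto simp: mono_def huber'_def)
  show "\<bar>huber' b x - huber' b y\<bar> \<le> \<bar>x - y\<bar>" for x y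
    using b by (auto simp: huber'_def)
  show "huber b 0 \<le> huber b s" for s
    by (simp add: huber_nonneg)
qed

lemma emb_0_minimizer: "emb 0 \<in> minimizers (Suc 0) (lift1 (huber b))"
  by (simp add: minimizers_lift1 huber_nonneg)

lemma emb_not_minimizer: "1 \<le> t \<Longrightarrow> emb t \<notin> minimizers (Suc 0) (lift1 (huber b))"
  by (auto simp: minimizers_lift1 huber_right intro!: exI[of _ 0])

section \<open>The gradient descent trajectory\<close>

lemma gd_huber_Suc:
  assumes "gd (Suc 0) (lift1 (huber b)) \<eta> x1 k = emb t"
  shows "gd (Suc 0) (lift1 (huber b)) \<eta> x1 (Suc k) = emb (t - \<eta> (Suc k) * huber' b t)"
  using assms by (auto simp: grad_lift1[OF DERIV_huber] emb_def)

text \<open>On the left slope step \<open>k\<close> adds \<open>b * \<eta> k\<close>, so the points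
  move right; \<open>b_le\<close> says that the last one is still at most \<open>-b\<close>.\<close>

lemma gd_huber:
  fixes \<eta> :: "nat \<Rightarrow> real"
  assumes pos: "\<And>k. k \<ge> 1 \<Longrightarrow> \<eta> k > 0" and m: "1 \<le> m" "m \<le> n"
    and b_le: "b * (1 + (\<Sum>k=m + 1..n. \<eta> k)) \<le> \<eta> m - 1"
  shows "gd (Suc 0) (lift1 (huber b)) \<eta> (emb (1 + (\<Sum>k=1..m - 1. \<eta> k))) n =
    emb (b * (\<Sum>k=m + 1..n. \<eta> k) - (\<eta> m - 1))"
proof -
  let ?gd = "gd (Suc 0) (lift1 (huber b)) \<eta> (emb (1 + (\<Sum>k=1..m - 1. \<eta> k)))"
  have sum_mono: "(\<Sum>k=j..i. \<eta> k) \<le> (\<Sum>k=j..i'. \<eta> k)" if "i \<le> i'" "1 \<le> j" for i i' j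
    using that pos by (intro sum_mono2) (auto intro!: less_imp_le)
  \<comment> \<open>Up to \<open>k = m - 1\<close> the partial sum does not exceed the full one, so
    each point is at least 1 and has slope 1.\<close>
  have right: "?gd k = emb (1 + (\<Sum>i=1..m - 1. \<eta> i) - (\<Sum>i=1..k. \<eta> i))" if "k \<le> m - 1" for k
    using that
  proof (induction k)
    case (Suc k)
    then show ?case
      using gd_huber_Suc[OF Suc.IH] sum_mono[of k "m - 1" 1]
      by (simp add: huber'_right algebra_simps)
  qed simp
  have start: "?gd m = emb (1 - \<eta> m)"
  proof -
    have Suc_m: "Suc (m - 1) = m"
      using m by simp
    \<comment> \<open>At the breakpoint 1 the slope is still 1, so step \<open>m\<close> has length
      \<open>\<eta> m\<close>.\<close>
    have "?gd (m - 1) = emb 1"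
      using right by simp
    from gd_huber_Suc[OF this] show ?thesis
      unfolding Suc_m by (simp add: huber'_right)
  qed
  have left: "?gd k = emb (b * (\<Sum>i=m + 1..k. \<eta> i) - (\<eta> m - 1))" if "m \<le> k" "k \<le> n" for k
    using that
  proof (induction k rule: dec_induct)
    case base
    show ?case using start by simp
  next
    case (step k)
    \<comment> \<open>No earlier point lies right of the final one, so the bound at \<open>n\<close>
      covers every \<open>k\<close>.\<close>
    have "b * (\<Sum>i=m + 1..k. \<eta> i) \<le> b * (\<Sum>i=m + 1..n. \<eta> i)"
      using step.prems b by (intro mult_left_mono sum_mono) auto
    also have "\<dots> \<le> \<eta> m - 1 - b"
      using b_le by (simp add: algebra_simps)
    finally have "b * (\<Sum>i=m + 1..k. \<eta> i) - (\<eta> m - 1) \<le> - b"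
      by simp
    then show ?case
      using gd_huber_Suc[OF step.IH] step
      by (simp add: huber'_left algebra_simps)
  qed
  show ?thesis using left m by simp
qed

end

section \<open>Lower bounds on the two rates\<close>

lemma R_rate_upper:
  assumes "d \<ge> 1" "f \<in> F1 d" "xs \<in> minimizers d f" "x1 \<in> espace d - minimizers d f"
  shows "ereal ((f (gd d f \<eta> x1 n) - f xs) / (1/2 * (edist d x1 xs)\<^sup>2)) \<le> R_rate n \<eta>"
  unfolding R_rate_def
  by (intro SUP_upper2[of d] SUP_upper2[of f] SUP_upper2[of xs] SUP_upper2[of x1])
    (use assms in auto)

lemma G_rate_upper:
  assumes "d \<ge> 1" "f \<in> F1 d" "xs \<in> minimizers d f" "x1 \<in> espace d - minimizers d f"
  shows "ereal ((1/2 * (enorm d (grad d f (gd d f \<eta> x1 n)))\<^sup>2) / (f x1 - f xs)) \<le> G_rate n \<eta>"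
  unfolding G_rate_def
  by (intro SUP_upper2[of d] SUP_upper2[of f] SUP_upper2[of xs] SUP_upper2[of x1])
    (use assms in auto)

text \<open>Start at \<open>emb t\<close> and compare with the minimizer \<open>emb 0\<close>: the
  squared distance is \<open>t^2\<close>, and the initial gap is \<open>t - 1/2\<close> since
  \<open>t\<close> lies on the right slope.\<close>

lemma huber_rates:
  assumes b: "0 < b" and t: "1 \<le> t"
    and gd: "gd (Suc 0) (lift1 (huber b)) \<eta> (emb t) n = emb z"
  shows "ereal (2 * huber b z / t\<^sup>2) \<le> R_rate n \<eta>"
    and "ereal ((huber' b z)\<^sup>2 / (2 * t - 1)) \<le> G_rate n \<eta>"
proof -
  note instance_facts = huber_in_F1[OF b] emb_0_minimizer[OF b]
    emb_not_minimizer[OF b t]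
  show "ereal (2 * huber b z / t\<^sup>2) \<le> R_rate n \<eta>"
    using R_rate_upper[of "Suc 0" "lift1 (huber b)" "emb 0" "emb t" \<eta> n] instance_facts b
    by (simp add: gd lift1_def mult.commute)
  have "(huber' b z)\<^sup>2 / (2 * t - 1) = (huber' b z)\<^sup>2 / 2 / (t - 1 / 2)"
    using t by (simp add: field_simps)
  then show "ereal ((huber' b z)\<^sup>2 / (2 * t - 1)) \<le> G_rate n \<eta>"
    using G_rate_upper[of "Suc 0" "lift1 (huber b)" "emb 0" "emb t" \<eta> n] instance_facts b t
    by (simp add: gd lift1_def grad_lift1[OF DERIV_huber] huber_right)
qed

text \<open>A supremum in \<open>ereal\<close> could a priori be negative; one instance with a
  nonnegative ratio excludes this.\<close>

lemma R_rate_nonneg: "0 \<le> R_rate n \<eta>"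
  and G_rate_nonneg: "0 \<le> G_rate n \<eta>"
proof -
  have "\<exists>z. gd (Suc 0) (lift1 (huber 1)) \<eta> (emb 1) n = emb z"
  proof (induction n)
    case (Suc n)
    then show ?case using gd_huber_Suc by (metis zero_less_one)
  qed auto
  then obtain z where z: "gd (Suc 0) (lift1 (huber 1)) \<eta> (emb 1) n = emb z" ..
  have "0 \<le> ereal (2 * huber 1 z / 1\<^sup>2)" and "0 \<le> ereal ((huber' 1 z)\<^sup>2 / (2 * 1 - 1))"
    by (simp_all add: huber_nonneg)
  then show "0 \<le> R_rate n \<eta>" "0 \<le> G_rate n \<eta>"
    using huber_rates[OF _ _ z] order_trans by (metis order_refl zero_less_one)+
qed

lemma rate_lower_bounds:
  fixes \<eta> :: "nat \<Rightarrow> real"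
  assumes pos: "\<And>k. k \<ge> 1 \<Longrightarrow> \<eta> k > 0" and m: "1 \<le> m" "m \<le> n" "\<eta> m > 1"
  shows "R_rate n \<eta> \<ge> ereal ((\<eta> m - 1)\<^sup>2 /
              ((1 + (\<Sum>k=1..m - 1. \<eta> k))\<^sup>2 * (1 + 2 * (\<Sum>k=m + 1..n. \<eta> k))))"
    and "G_rate n \<eta> \<ge> ereal ((\<eta> m - 1)\<^sup>2 /
              ((1 + 2 * (\<Sum>k=1..m - 1. \<eta> k)) * (1 + (\<Sum>k=m + 1..n. \<eta> k))\<^sup>2))"
proof -
  define A where "A = (\<Sum>k=1..m - 1. \<eta> k)"
  define B where "B = (\<Sum>k=m + 1..n. \<eta> k)"
  define y where "y = \<eta> m - 1"
  have A: "0 \<le> A" and B: "0 \<le> B"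
    unfolding A_def B_def using pos by (auto intro!: sum_nonneg simp: less_imp_le)
  have y: "0 < y"
    using m by (simp add: y_def)
  have gd: "gd (Suc 0) (lift1 (huber b)) \<eta> (emb (1 + A)) n = emb (b * B - y)"
    if "0 < b" "b * (1 + B) \<le> y" for b
    using gd_huber[OF that(1) pos m(1,2)] that(2) unfolding A_def B_def y_def by simp
  have left: "b * B - y \<le> - b" if "b * (1 + B) \<le> y" for b
    using that by (simp add: algebra_simps)
  show "R_rate n \<eta> \<ge> ereal ((\<eta> m - 1)\<^sup>2 /
              ((1 + (\<Sum>k=1..m - 1. \<eta> k))\<^sup>2 * (1 + 2 * (\<Sum>k=m + 1..n. \<eta> k))))"
  proof -
    \<comment> \<open>Twice the final value is \<open>2 * b * y - b^2 * (1 + 2 * B)\<close>, a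
      concave quadratic in \<open>b\<close> with this maximiser.\<close>
    define b where "b = y / (1 + 2 * B)"
    have b: "0 < b" and y_eq: "y = b * (1 + 2 * B)"
      using y B by (simp_all add: b_def)
    have le: "b * (1 + B) \<le> y"
      unfolding y_eq using b B by (intro mult_left_mono) auto
    have "2 * huber b (b * B - y) = b * y"
      using huber_left[OF b left[OF le]] by (simp add: y_eq power2_eq_square algebra_simps)
    also have "\<dots> = y\<^sup>2 / (1 + 2 * B)"
      by (simp add: b_def power2_eq_square)
    finally have "ereal (y\<^sup>2 / (1 + 2 * B) / (1 + A)\<^sup>2) \<le> R_rate n \<eta>"
      using huber_rates(1)[OF b _ gd[OF b le]] A by simp
    then show ?thesis
      by (simp add: A_def B_def y_def mult.commute)
  qed
  show "G_rate n \<eta> \<ge> ereal ((\<eta> m - 1)\<^sup>2 /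
              ((1 + 2 * (\<Sum>k=1..m - 1. \<eta> k)) * (1 + (\<Sum>k=m + 1..n. \<eta> k))\<^sup>2))"
  proof -
    \<comment> \<open>The final slope is \<open>-b\<close>, so \<open>b\<close> is the largest value
      that \<open>gd\<close> admits; the last point is then exactly \<open>-b\<close>.\<close>
    define b where "b = y / (1 + B)"
    have b: "0 < b" and le: "b * (1 + B) \<le> y"
      using y B by (simp_all add: b_def)
    have "(huber' b (b * B - y))\<^sup>2 = y\<^sup>2 / (1 + B)\<^sup>2"
      using huber'_left[OF b left[OF le]] by (simp add: b_def power_divide)
    moreover have "2 * (1 + A) - 1 = 1 + 2 * A"
      by simp
    ultimately have "ereal (y\<^sup>2 / (1 + B)\<^sup>2 / (1 + 2 * A)) \<le> G_rate n \<eta>"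
      using huber_rates(2)[OF b _ gd[OF b le]] A by simp
    then show ?thesis
      by (simp add: A_def B_def y_def mult.commute)
  qed
qed

section \<open>Bounds on the last stepsize\<close>

text \<open>Take square roots in \<open>bound\<close> when \<open>1 < t\<close> and \<open>X\<close>
  is finite. Otherwise the right side is infinite, or at least 1 and so at least
  \<open>t\<close>.\<close>

lemma le_one_plus_esqrt:
  assumes c: "0 < c" and X: "0 \<le> X" and bound: "1 < t \<Longrightarrow> ereal ((t - 1)\<^sup>2 / c\<^sup>2) \<le> X"
  shows "ereal t \<le> 1 + ereal c * esqrt X"
proof (cases X)
  case (real r)
  have "t - 1 \<le> c * sqrt r"
  proof (cases "1 < t")
    case True
    then have "(t - 1) / c \<le> sqrt r"
      using bound real c by (intro real_le_rsqrt) (simp add: power_divide)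
    then show ?thesis
      using c by (simp add: field_simps)
  next
    case False
    have "0 \<le> c * sqrt r"
      using X real c by simp
    with False show ?thesis by linarith
  qed
  then show ?thesis
    by (simp add: real esqrt_def one_ereal_def)
next
  case PInf
  then show ?thesis using c by (simp add: esqrt_def)
next
  case MInf
  then show ?thesis using X by simp
qed

theorem lemma3p1:
  fixes \<eta> :: "nat \<Rightarrow> real" and n :: nat
  assumes "\<And>k. k \<ge> 1 \<Longrightarrow> \<eta> k > 0" and "n \<ge> 1"
  shows "(\<forall>m\<in>{1..n}. \<eta> m > 1 \<longrightarrow>
            R_rate n \<eta> \<ge> ereal ((\<eta> m - 1)\<^sup>2 /
              ((1 + (\<Sum>k=1..m - 1. \<eta> k))\<^sup>2 * (1 + 2 * (\<Sum>k=m + 1..n. \<eta> k)))) \<and>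
            G_rate n \<eta> \<ge> ereal ((\<eta> m - 1)\<^sup>2 /
              ((1 + 2 * (\<Sum>k=1..m - 1. \<eta> k)) * (1 + (\<Sum>k=m + 1..n. \<eta> k))\<^sup>2))) \<and>
         ereal (\<eta> n) \<le> 1 + ereal (1 + (\<Sum>k=1..n - 1. \<eta> k)) * esqrt (R_rate n \<eta>) \<and>
         ereal (\<eta> n) \<le> 1 + ereal (sqrt (1 + 2 * (\<Sum>k=1..n - 1. \<eta> k))) * esqrt (G_rate n \<eta>)"
proof (intro conjI ballI impI)
  have A: "0 \<le> (\<Sum>k=1..n - 1. \<eta> k)"
    using assms(1) by (auto intro!: sum_nonneg simp: less_imp_le)
  show "ereal (\<eta> n) \<le> 1 + ereal (1 + (\<Sum>k=1..n - 1. \<eta> k)) * esqrt (R_rate n \<eta>)"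
    \<comment> \<open>With \<open>m = n\<close> the sum from \<open>n + 1\<close> to
      \<open>n\<close> is empty, which leaves a denominator of the form \<open>c^2\<close>.\<close>
    using rate_lower_bounds(1)[of \<eta> n n] assms A
    by (intro le_one_plus_esqrt R_rate_nonneg) auto
  show "ereal (\<eta> n) \<le> 1 + ereal (sqrt (1 + 2 * (\<Sum>k=1..n - 1. \<eta> k))) * esqrt (G_rate n \<eta>)"
    \<comment> \<open>Here \<open>c\<close> is itself a square root; by \<open>A\<close> its
      radicand is positive and equals \<open>c^2\<close>.\<close>
    using rate_lower_bounds(2)[of \<eta> n n] assms A
    by (intro le_one_plus_esqrt G_rate_nonneg) auto
qed (use rate_lower_bounds assms in auto)

end
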